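(* Consider a Markov decision process with finite state set $X$, finite action set $A$, nonempty admissible action sets $A(x)\subseteq A$ $(x\in X)$, transition probabilities $P^a_{xy}$, reward function $R:X\times A\to\mathbb{R}$ and discount factor $\gamma\in(0,1)$, and let $\Pi$ be its set of policies. Let $\{\pi_{k+1},k\geq 0\}$ be a sequence of policies generated by on-line policy-switching policy iteration (on-line PSPI), started from an arbitrary $\pi_0\in\Pi$, along the state trajectory $\{x_k, k\ge 0\}$ of the system. Then $V^{\pi_{k+1}}\geq V^{\pi_k}$ for all $k\geq 0$.
   Context: A policy is a map $\pi:X\to A$ with $\pi(x)\in A(x)$ for all $x\in X$; $\Pi$ is the set of all policies. When action $a\in A(x)$ is taken in state $x$, the reward $R(x,a)$ is obtained and the next state is $y$ with probability $P^a_{xy}$. The value function of $\pi\in\Pi$ is $$V^{\pi}(x)=E\Big[\sum_{t=0}^{\infty}\gamma^t R(X_t,\pi(X_t))\,\Big|\,X_0=x\Big],\quad x\in X,$$ where $X_t$ is the random state at time $t$ when following $\pi$. Inequalities between functions on $X$ are componentwise. For $\pi\in\Pi$ and $x\in X$, let $\beta^{\pi}_x=\{\pi'\in\Pi : \pi'(s)=\pi(s)\ \text{for all } s\in X\setminus\{x\}\}$ (so $\pi\in\beta^{\pi}_x$, and $\beta^\pi_x$ has exactly $|A(x)|$ elements). Policy switching: for nonempty $\Delta\subseteq\Pi$, $\pi_{\mathrm{ps}}(\Delta)\in\Pi$ denotes a policy such that for every $x\in X$, $\pi_{\mathrm{ps}}(\Delta)(x)=\phi_x(x)$ for some $\phi_x\in\arg\max_{\phi\in\Delta}V^{\phi}(x)$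 (ties broken arbitrarily). On-line PSPI: start with an arbitrary $\pi_0\in\Pi$ and the system's initial state $x_0\in X$. At each time $k\geq 0$, with the system at state $x_k$, set $\pi_{k+1}(x_k)=\pi_{\mathrm{ps}}(\beta^{\pi_k}_{x_k})(x_k)$ and $\pi_{k+1}(x)=\pi_k(x)$ for all $x\in X\setminus\{x_k\}$; take action $\pi_{k+1}(x_k)$ at $x_k$, after which the system moves to a random next state $x_{k+1}$, equal to $y$ with probability $P^{\pi_{k+1}(x_k)}_{x_ky}$. The assertion is for every realization of the state trajectory; $V^{\pi_k}$ is the value function of the fixed (stationary) policy $\pi_k$. *)

theory Defs
  imports "HOL-Probability.Probability"
begin

text \<open>
  The states and the actions form finite types \<open>'x\<close> and \<open>'a\<close>, \<open>A x\<close> is the set of actions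
  admissible in state \<open>x\<close>, and \<open>pmf (P x a) y\<close> is the transition probability from \<open>x\<close> to \<open>y\<close>
  under action \<open>a\<close>.  Only admissible actions are ever used by policies, so the values of
  \<open>P x a\<close> and \<open>R x a\<close> for \<open>a \<notin> A x\<close> are irrelevant.
\<close>

definition policies :: "('x \<Rightarrow> 'a set) \<Rightarrow> ('x \<Rightarrow> 'a) set" where
  "policies A = {\<pi>. \<forall>x. \<pi> x \<in> A x}"

text \<open>
  The law of the state process \<open>X\<^sub>0 = x, X\<^sub>1, X\<^sub>2, \<dots>\<close> under \<open>\<pi>\<close>, on the space of
  state sequences: \<open>state_kernel P \<pi> x t \<omega>\<close> is the conditional law of \<open>X\<^sub>t\<close> given the
  past states \<open>\<omega> 0, \<dots>, \<omega> (t - 1)\<close>, and the theorem of Ionescu-Tulcea glues these together.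
\<close>

definition state_kernel ::
    "('x \<Rightarrow> 'a \<Rightarrow> 'x pmf) \<Rightarrow> ('x \<Rightarrow> 'a) \<Rightarrow> 'x \<Rightarrow> nat \<Rightarrow> (nat \<Rightarrow> 'x) \<Rightarrow> 'x measure" where
  "state_kernel P \<pi> x t \<omega> =
     measure_pmf (case t of 0 \<Rightarrow> return_pmf x | Suc s \<Rightarrow> P (\<omega> s) (\<pi> (\<omega> s)))"

definition trajectory_measure ::
    "('x \<Rightarrow> 'a \<Rightarrow> 'x pmf) \<Rightarrow> ('x \<Rightarrow> 'a) \<Rightarrow> 'x \<Rightarrow> (nat \<Rightarrow> 'x) measure" where
  "trajectory_measure P \<pi> x =
     projective_family.lim UNIV
       (Ionescu_Tulcea.CI (state_kernel P \<pi> x) (\<lambda>_. count_space UNIV)) (\<lambda>_. count_space UNIV)"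

definition value_fun ::
    "('x \<Rightarrow> 'a \<Rightarrow> 'x pmf) \<Rightarrow> ('x \<Rightarrow> 'a \<Rightarrow> real) \<Rightarrow> real \<Rightarrow> ('x \<Rightarrow> 'a) \<Rightarrow> 'x \<Rightarrow> real" where
  "value_fun P R \<gamma> \<pi> x =
     (\<integral>\<omega>. (\<Sum>t. \<gamma> ^ t * R (\<omega> t) (\<pi> (\<omega> t))) \<partial>trajectory_measure P \<pi> x)"

definition one_state_variants ::
    "('x \<Rightarrow> 'a set) \<Rightarrow> ('x \<Rightarrow> 'a) \<Rightarrow> 'x \<Rightarrow> ('x \<Rightarrow> 'a) set" where
  "one_state_variants A \<pi> x = {\<pi>' \<in> policies A. \<forall>s. s \<noteq> x \<longrightarrow> \<pi>' s = \<pi> s}"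

text \<open>
  A relation rather than a function, since ties are broken arbitrarily: \<open>\<pi>\<close> is one of the
  policies obtained by policy switching from \<open>\<Delta>\<close>.
\<close>

definition policy_switching ::
    "('x \<Rightarrow> 'a \<Rightarrow> 'x pmf) \<Rightarrow> ('x \<Rightarrow> 'a \<Rightarrow> real) \<Rightarrow> real \<Rightarrow> ('x \<Rightarrow> 'a) set \<Rightarrow> ('x \<Rightarrow> 'a) \<Rightarrow> bool" where
  "policy_switching P R \<gamma> \<Delta> \<pi> \<longleftrightarrow>
     (\<forall>x. \<exists>\<phi>. is_arg_max (\<lambda>\<psi>. value_fun P R \<gamma> \<psi> x) (\<lambda>\<psi>. \<psi> \<in> \<Delta>) \<phi> \<and> \<pi> x = \<phi> x)"

text \<open>
  \<open>\<pi>\<close> is a policy sequence and \<open>x\<close> a state trajectory jointly realizable by a run of on-line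
  PSPI: \<open>x (Suc k)\<close> is any state that the random transition reaches with positive probability.
\<close>

definition online_PSPI ::
    "('x \<Rightarrow> 'a set) \<Rightarrow> ('x \<Rightarrow> 'a \<Rightarrow> 'x pmf) \<Rightarrow> ('x \<Rightarrow> 'a \<Rightarrow> real) \<Rightarrow> real \<Rightarrow>
     (nat \<Rightarrow> 'x \<Rightarrow> 'a) \<Rightarrow> (nat \<Rightarrow> 'x) \<Rightarrow> bool" where
  "online_PSPI A P R \<gamma> \<pi> x \<longleftrightarrow>
     \<pi> 0 \<in> policies A \<and>
     (\<forall>k. (\<exists>\<pi>\<^sub>p\<^sub>s. policy_switching P R \<gamma> (one_state_variants A (\<pi> k) (x k)) \<pi>\<^sub>p\<^sub>s \<and>
                 \<pi> (Suc k) (x k) = \<pi>\<^sub>p\<^sub>s (x k)) \<and>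
          (\<forall>s. s \<noteq> x k \<longrightarrow> \<pi> (Suc k) s = \<pi> k s) \<and>
          x (Suc k) \<in> set_pmf (P (x k) (\<pi> (Suc k) (x k))))"

text \<open>The trajectory measure and the expectation in \<open>value_fun\<close> are well-defined.\<close>

lemma Ionescu_Tulcea_state_kernel:
  fixes P :: "'x::finite \<Rightarrow> 'a \<Rightarrow> 'x pmf"
  shows "Ionescu_Tulcea (state_kernel P \<pi> x) (\<lambda>_. count_space UNIV)"
proof (rule Ionescu_Tulcea.intro)
  fix t :: nat
  show "state_kernel P \<pi> x t \<in> PiM {0..<t} (\<lambda>_. count_space UNIV) \<rightarrow>\<^sub>M
          subprob_algebra (count_space UNIV)"
  proof (cases t)
    case 0
    then show ?thesis
      by (simp add: state_kernel_def[abs_def] measure_pmf_in_subprob_algebra)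
  next
    case (Suc s)
    have 1: "(\<lambda>\<omega>. \<omega> s) \<in> PiM {0..<t} (\<lambda>_. count_space (UNIV :: 'x set)) \<rightarrow>\<^sub>M count_space UNIV"
      using Suc by (intro measurable_component_singleton) auto
    have 2: "(\<lambda>y. measure_pmf (P y (\<pi> y))) \<in> count_space UNIV \<rightarrow>\<^sub>M
          subprob_algebra (count_space UNIV)"
      by (auto simp: space_subprob_algebra measure_pmf.subprob_space_axioms)
    from measurable_compose[OF 1 2] Suc show ?thesis
      by (simp add: state_kernel_def[abs_def])
  qed
next
  fix t :: nat and \<omega> :: "nat \<Rightarrow> 'x"
  show "prob_space (state_kernel P \<pi> x t \<omega>)"
    by (simp add: state_kernel_def measure_pmf.prob_space_axioms)
qed

lemma
  fixes P :: "'x::finite \<Rightarrow> 'a \<Rightarrow> 'x pmf"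
  shows prob_space_trajectory_measure: "prob_space (trajectory_measure P \<pi> x)"
    and sets_trajectory_measure:
      "sets (trajectory_measure P \<pi> x) = sets (PiM UNIV (\<lambda>_. count_space UNIV))"
proof -
  interpret Ionescu_Tulcea "state_kernel P \<pi> x" "\<lambda>_. count_space UNIV"
    by (rule Ionescu_Tulcea_state_kernel)
  show "prob_space (trajectory_measure P \<pi> x)"
  proof (rule prob_spaceI)
    interpret CI: prob_space "CI {}"
      by (rule PF.prob_space_P) simp_all
    have "sets (CI {}) = sets (PiM {} (\<lambda>_. count_space UNIV))"
      by (rule PF.sets_P) simp_all
    then have "emeasure (CI {}) (space (PiM {} (\<lambda>_. count_space UNIV))) = 1"
      using CI.emeasure_space_1 sets_eq_imp_space_eq by metis
    then show "emeasure (trajectory_measure P \<pi> x) (space (trajectory_measure P \<pi> x)) = 1"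
      using lim[OF finite.emptyI sets.top]
      by (simp add: trajectory_measure_def prod_emb_def space_PiM vimage_def restrict_def)
  qed
  show "sets (trajectory_measure P \<pi> x) = sets (PiM UNIV (\<lambda>_. count_space UNIV))"
    unfolding trajectory_measure_def by simp
qed

lemma
  fixes P :: "'x::finite \<Rightarrow> 'a \<Rightarrow> 'x pmf" and \<gamma> :: real
  assumes "0 < \<gamma>" "\<gamma> < 1"
  shows summable_discounted_reward: "summable (\<lambda>t. \<gamma> ^ t * R (\<omega> t) (\<pi> (\<omega> t)))"
    and integrable_discounted_reward:
      "integrable (trajectory_measure P \<pi> x) (\<lambda>\<omega>. \<Sum>t. \<gamma> ^ t * R (\<omega> t) (\<pi> (\<omega> t)))"
proof -
  define B where "B = Max (range (\<lambda>y. \<bar>R y (\<pi> y)\<bar>))"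
  have B: "\<bar>R y (\<pi> y)\<bar> \<le> B" for y
    unfolding B_def by (rule Max_ge) auto
  have b: "norm (\<gamma> ^ t * R (\<omega> t) (\<pi> (\<omega> t))) \<le> \<gamma> ^ t * B" for t \<omega>
    using B[of "\<omega> t"] assms by (simp add: abs_mult mult_left_mono)
  have g: "summable (\<lambda>t. \<gamma> ^ t * B)"
    using assms by (intro summable_mult2 summable_geometric) simp
  show s: "summable (\<lambda>t. \<gamma> ^ t * R (\<omega> t) (\<pi> (\<omega> t)))" for \<omega>
    by (rule summable_comparison_test'[OF g b])
  interpret prob_space "trajectory_measure P \<pi> x"
    by (rule prob_space_trajectory_measure)
  note [measurable_cong] = sets_trajectory_measure[of P \<pi> x]
  have m: "(\<lambda>\<omega>. R (\<omega> t) (\<pi> (\<omega> t))) \<in> borel_measurable (trajectory_measure P \<pi> x)" for t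
    by (rule measurable_compose[where f = "\<lambda>\<omega>. \<omega> t" and g = "\<lambda>y. R y (\<pi> y)"
          and N = "count_space UNIV"]) auto
  show "integrable (trajectory_measure P \<pi> x) (\<lambda>\<omega>. \<Sum>t. \<gamma> ^ t * R (\<omega> t) (\<pi> (\<omega> t)))"
  proof (rule integrable_const_bound)
    show "AE \<omega> in trajectory_measure P \<pi> x.
        norm (\<Sum>t. \<gamma> ^ t * R (\<omega> t) (\<pi> (\<omega> t))) \<le> (\<Sum>t. \<gamma> ^ t * B)"
      by (intro always_eventually allI norm_suminf_le b g)
    show "(\<lambda>\<omega>. \<Sum>t. \<gamma> ^ t * R (\<omega> t) (\<pi> (\<omega> t))) \<in> borel_measurable (trajectory_measure P \<pi> x)"
      using m by measurable
  qed
qed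

end

theory Submission
  imports Defs
begin

text \<open>
  One step of on-line PSPI changes the policy only at the current state \<open>z = x k\<close>.  The action
  chosen there is that of some maximiser \<open>\<phi>\<close> of the value at \<open>z\<close> among the one-state variants of
  \<open>\<pi> k\<close>; since all variants agree away from \<open>z\<close>, the new policy \<^emph>\<open>is\<close> \<open>\<phi>\<close>
  (\<open>online_PSPI_step\<close>).  The old policy is a variant of itself, so the value at \<open>z\<close> does not drop.

  The improvement at \<open>z\<close> spreads to the other states (\<open>value_fun_mono_one_state\<close>).  Let \<open>D\<close> be the
  new value minus the old one.  At every state other than \<open>z\<close> both policies have the same one-step
  reward and the same transition law, so subtracting their Bellman equations
  (\<open>value_fun_Bellman\<close>) shows that \<open>D\<close> there is \<open>\<gamma>\<close> times an average of \<open>D\<close>.  A negative minimum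
  of \<open>D\<close> could then only be attained at \<open>z\<close>, because elsewhere it would be at least \<open>\<gamma>\<close> times
  itself; but \<open>D z \<ge> 0\<close> (\<open>discounted_minimum_principle\<close>).

  Most of the work goes into the Bellman equation, since values are integrals over infinite
  trajectories.  The value depends on the trajectory measure only through the law of each single
  \<open>X\<^sub>t\<close>, and the Ionescu-Tulcea construction, which appends states at the end of a trajectory,
  gives these laws by iterating the transition kernel (\<open>distr_trajectory_measure\<close>).  For the
  Bellman equation the first transition has to be split off instead;
  \<open>state_law_Suc_last\<close> says that both orders of iteration agree.
\<close>

section \<open>The law of a single state of the trajectory\<close>

text \<open>The recursion conditions on the first transition, which is the form that the Bellman
  equation needs.\<close>

primrec state_law :: "('x \<Rightarrow> 'x pmf) \<Rightarrow> nat \<Rightarrow> 'x \<Rightarrow> 'x pmf" where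
  "state_law K 0 x = return_pmf x"
| "state_law K (Suc t) x = bind_pmf (K x) (state_law K t)"

text \<open>By associativity of \<open>bind_pmf\<close>.  This is the recursion that the trajectory measure
  satisfies by construction.\<close>

lemma state_law_Suc_last: "state_law K (Suc t) x = bind_pmf (state_law K t x) K"
proof (induction t arbitrary: x)
  case 0
  have "state_law K 0 = return_pmf" by (rule ext) simp
  then show ?case by (simp add: bind_return_pmf bind_return_pmf')
next
  case (Suc t)
  have "state_law K (Suc (Suc t)) x = bind_pmf (K x) (\<lambda>y. bind_pmf (state_law K t y) K)"
    unfolding state_law.simps(2)[of K "Suc t"] by (intro bind_pmf_cong refl Suc.IH)
  then show ?case by (simp add: bind_assoc_pmf)
qed

text \<open>
  The first \<open>t + 1\<close> coordinates of the trajectory follow the finite-horizon law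
  \<open>C 0 (Suc t)\<close>.  Projecting its last extension step to the new coordinate leaves the state
  kernel, which looks only at the preceding state; so the marginals satisfy the Markov recursion.
\<close>

lemma distr_trajectory_measure:
  fixes P :: "'x::finite \<Rightarrow> 'a \<Rightarrow> 'x pmf"
  shows "distr (trajectory_measure P \<pi> x) (count_space UNIV) (\<lambda>\<omega>. \<omega> t) =
    measure_pmf (state_law (\<lambda>y. P y (\<pi> y)) t x)"
proof -
  let ?M = "\<lambda>_::nat. count_space (UNIV :: 'x set)"
  let ?K = "\<lambda>y. P y (\<pi> y)"
  interpret Ionescu_Tulcea "state_kernel P \<pi> x" ?M
    by (rule Ionescu_Tulcea_state_kernel)
  let ?C = "\<lambda>n. C 0 n (\<lambda>_. undefined)"
  have [simp]: "(\<lambda>_. undefined) \<in> space (PiM {0..<0} ?M)"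
    by (simp add: space_PiM)
  have sC: "sets (?C n) = sets (PiM {0..<n} ?M)" for n
    using sets_C[of "\<lambda>_. undefined" 0 n] by simp
  have spC: "space (?C n) = space (PiM {0..<n} ?M)" for n
    using sC by (rule sets_eq_imp_space_eq)
  have comp: "(\<lambda>\<omega>. \<omega> n) \<in> PiM {0..<Suc n} ?M \<rightarrow>\<^sub>M count_space UNIV" for n
    by (rule measurable_component_singleton) simp
  have step: "distr (?C (Suc n)) (count_space UNIV) (\<lambda>\<omega>. \<omega> n) =
      ?C n \<bind> state_kernel P \<pi> x n" for n
  proof -
    have eP: "eP n \<in> ?C n \<rightarrow>\<^sub>M subprob_algebra (PiM {0..<Suc n} ?M)"
      using measurable_eP[of n] by (simp add: measurable_cong_sets[OF sC refl])
    have ne: "space (?C n) \<noteq> {}"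
      by (intro prob_space.not_empty prob_space_C) simp
    have last: "distr (eP n \<omega>) (count_space UNIV) (\<lambda>\<omega>. \<omega> n) = state_kernel P \<pi> x n \<omega>"
      if "\<omega> \<in> space (?C n)" for \<omega>
    proof -
      have \<omega>: "\<omega> \<in> space (PiM {0..<n} ?M)" using that spC by simp
      have s: "sets (state_kernel P \<pi> x n \<omega>) = sets (count_space UNIV)"
        using sets_P[OF \<omega>] .
      have "fun_upd \<omega> n \<in> state_kernel P \<pi> x n \<omega> \<rightarrow>\<^sub>M PiM {0..<Suc n} ?M"
        using \<omega> by (intro measurable_fun_upd[where J="{0..<n}"]) (auto simp: measurable_cong_sets[OF s refl])
      then have "distr (eP n \<omega>) (count_space UNIV) (\<lambda>\<omega>. \<omega> n) =
          distr (state_kernel P \<pi> x n \<omega>) (count_space UNIV) (\<lambda>y. y)"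
        unfolding eP_def by (subst distr_distr[OF comp]) (simp_all add: comp_def)
      also have "\<dots> = state_kernel P \<pi> x n \<omega>"
        using s by (intro distr_id2) simp
      finally show ?thesis .
    qed
    have "distr (?C (Suc n)) (count_space UNIV) (\<lambda>\<omega>. \<omega> n) =
        ?C n \<bind> (\<lambda>\<omega>. distr (eP n \<omega>) (count_space UNIV) (\<lambda>\<omega>. \<omega> n))"
      using distr_bind[OF eP ne comp] by simp
    also have "\<dots> = ?C n \<bind> state_kernel P \<pi> x n"
      by (intro bind_cong refl last)
    finally show ?thesis .
  qed
  have marginal: "distr (?C (Suc n)) (count_space UNIV) (\<lambda>\<omega>. \<omega> n) = measure_pmf (state_law ?K n x)" for n
  proof (induction n)
    case 0
    have "distr (?C (Suc 0)) (count_space UNIV) (\<lambda>\<omega>. \<omega> 0) = ?C 0 \<bind> (\<lambda>_. measure_pmf (return_pmf x))"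
      unfolding step by (simp add: state_kernel_def[abs_def])
    also have "\<dots> = measure_pmf (return_pmf x)"
      by (rule bind_const'[OF prob_space_C]) (auto intro: measure_pmf.subprob_space_axioms)
    finally show ?case by simp
  next
    case (Suc n)
    have K: "(\<lambda>y. measure_pmf (?K y)) \<in> count_space UNIV \<rightarrow>\<^sub>M subprob_algebra (count_space UNIV)"
      by (rule measurable_measure_pmf)
    have ne: "space (?C (Suc n)) \<noteq> {}"
      by (intro prob_space.not_empty prob_space_C) simp
    have c: "(\<lambda>\<omega>. \<omega> n) \<in> ?C (Suc n) \<rightarrow>\<^sub>M count_space UNIV"
      using comp by (simp add: measurable_cong_sets[OF sC refl] del: C.simps)
    have "distr (?C (Suc (Suc n))) (count_space UNIV) (\<lambda>\<omega>. \<omega> (Suc n)) =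
        ?C (Suc n) \<bind> (\<lambda>\<omega>. measure_pmf (?K (\<omega> n)))"
      unfolding step by (simp add: state_kernel_def[abs_def])
    also have "\<dots> = distr (?C (Suc n)) (count_space UNIV) (\<lambda>\<omega>. \<omega> n) \<bind> (\<lambda>y. measure_pmf (?K y))"
      by (rule bind_distr[OF c K ne, symmetric])
    also have "\<dots> = measure_pmf (bind_pmf (state_law ?K n x) ?K)"
      unfolding Suc.IH by (rule measure_pmf_bind[symmetric])
    finally show ?case by (simp only: state_law_Suc_last)
  qed
  have up: "up_to {0..<Suc t} = Suc t"
    by (rule antisym) (auto simp: up_to_iff Suc_le_eq intro: up_to_less)
  let ?J = "{0..<Suc t}"
  have "CI ?J = ?C (Suc t)"
    unfolding CI_def up using distr_C[of "Suc t" "Suc t" "\<lambda>_. undefined" 0] by simp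
  then have "distr PF.lim (PiM ?J ?M) (\<lambda>\<omega>. restrict \<omega> ?J) = ?C (Suc t)"
    using distr_lim[of ?J] by simp
  then have "distr (?C (Suc t)) (count_space UNIV) (\<lambda>\<omega>. \<omega> t) =
      distr (distr PF.lim (PiM ?J ?M) (\<lambda>\<omega>. restrict \<omega> ?J)) (count_space UNIV) (\<lambda>\<omega>. \<omega> t)"
    by simp
  also have "\<dots> = distr PF.lim (count_space UNIV) (\<lambda>\<omega>. \<omega> t)"
    by (subst distr_distr[OF comp])
       (auto simp: measurable_cong_sets[OF PF.sets_lim refl] comp_def intro!: measurable_restrict_subset)
  finally show ?thesis
    unfolding trajectory_measure_def marginal by simp
qed

section \<open>The Bellman equation\<close>

lemma integral_trajectory_measure:
  fixes P :: "'x::finite \<Rightarrow> 'a \<Rightarrow> 'x pmf" and f :: "'x \<Rightarrow> real"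
  shows "(\<integral>\<omega>. f (\<omega> t) \<partial>trajectory_measure P \<pi> x) =
    measure_pmf.expectation (state_law (\<lambda>y. P y (\<pi> y)) t x) f"
proof -
  have "(\<lambda>\<omega>. \<omega> t) \<in> trajectory_measure P \<pi> x \<rightarrow>\<^sub>M count_space UNIV"
    by (simp add: measurable_cong_sets[OF sets_trajectory_measure refl])
  then show ?thesis
    unfolding distr_trajectory_measure[symmetric] by (subst integral_distr) auto
qed

lemma summable_bounded_discounted:
  fixes f :: "nat \<Rightarrow> real"
  assumes "0 < \<gamma>" "\<gamma> < 1" "\<And>t. \<bar>f t\<bar> \<le> B"
  shows "summable (\<lambda>t. \<gamma> ^ t * f t)"
proof (rule summable_comparison_test')
  show "summable (\<lambda>t. \<gamma> ^ t * B)"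
    using assms by (intro summable_mult2 summable_geometric) simp
  show "norm (\<gamma> ^ t * f t) \<le> \<gamma> ^ t * B" for t
    using assms by (simp add: abs_mult mult_left_mono)
qed

text \<open>Rewards on a finite state space are bounded, so the expectation may be taken term by
  term.\<close>

lemma
  fixes P :: "'x::finite \<Rightarrow> 'a \<Rightarrow> 'x pmf" and R :: "'x \<Rightarrow> 'a \<Rightarrow> real"
    and \<pi> :: "'x \<Rightarrow> 'a" and \<gamma> :: real
  assumes \<gamma>: "0 < \<gamma>" "\<gamma> < 1"
  defines "E \<equiv> \<lambda>t x. measure_pmf.expectation (state_law (\<lambda>y. P y (\<pi> y)) t x) (\<lambda>y. R y (\<pi> y))"
  shows summable_expected_reward: "summable (\<lambda>t. \<gamma> ^ t * E t x)"
    and value_fun_series: "value_fun P R \<gamma> \<pi> x = (\<Sum>t. \<gamma> ^ t * E t x)"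
proof -
  let ?r = "\<lambda>y. R y (\<pi> y)"
  let ?T = "trajectory_measure P \<pi> x"
  define B where "B = Max (range (\<lambda>y. \<bar>?r y\<bar>))"
  have B: "\<bar>?r y\<bar> \<le> B" for y
    unfolding B_def by (rule Max_ge) auto
  interpret T: prob_space ?T
    by (rule prob_space_trajectory_measure)
  note [measurable_cong] = sets_trajectory_measure[of P \<pi> x]
  have m[measurable]: "(\<lambda>\<omega>. f (\<omega> t)) \<in> borel_measurable ?T" for t and f :: "'x \<Rightarrow> real"
    by (rule measurable_compose[where f = "\<lambda>\<omega>. \<omega> t" and g = f and N = "count_space UNIV"]) auto
  have int: "integrable ?T (\<lambda>\<omega>. f (\<omega> t))" if "\<And>y. \<bar>f y\<bar> \<le> B" for t and f :: "'x \<Rightarrow> real"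
    using that by (intro T.integrable_const_bound[where B = B]) auto
  have bound: "\<bar>\<integral>\<omega>. f (\<omega> t) \<partial>?T\<bar> \<le> B" if "\<And>y. \<bar>f y\<bar> \<le> B" for t and f :: "'x \<Rightarrow> real"
  proof -
    have "\<bar>\<integral>\<omega>. f (\<omega> t) \<partial>?T\<bar> \<le> (\<integral>\<omega>. \<bar>f (\<omega> t)\<bar> \<partial>?T)" by simp
    also have "\<dots> \<le> B"
      using that by (intro T.integral_le_const int integrable_abs) auto
    finally show ?thesis .
  qed
  have E: "(\<integral>\<omega>. ?r (\<omega> t) \<partial>?T) = E t x" for t
    unfolding E_def by (rule integral_trajectory_measure)
  show "summable (\<lambda>t. \<gamma> ^ t * E t x)"
    unfolding E[symmetric] by (rule summable_bounded_discounted[OF \<gamma> bound[of ?r, OF B]])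
  have "value_fun P R \<gamma> \<pi> x = (\<Sum>t. \<integral>\<omega>. \<gamma> ^ t * ?r (\<omega> t) \<partial>?T)"
    unfolding value_fun_def
  proof (rule integral_suminf)
    show "integrable ?T (\<lambda>\<omega>. \<gamma> ^ t * ?r (\<omega> t))" for t
      by (intro integrable_mult_right int B)
    show "AE \<omega> in ?T. summable (\<lambda>t. norm (\<gamma> ^ t * ?r (\<omega> t)))"
      using summable_bounded_discounted[OF \<gamma>, where B = B] B \<gamma> by (simp add: abs_mult)
    have "summable (\<lambda>t. \<gamma> ^ t * (\<integral>\<omega>. \<bar>?r (\<omega> t)\<bar> \<partial>?T))"
      using bound[of "\<lambda>y. \<bar>?r y\<bar>"] B by (intro summable_bounded_discounted[OF \<gamma>]) auto
    then show "summable (\<lambda>t. \<integral>\<omega>. norm (\<gamma> ^ t * ?r (\<omega> t)) \<partial>?T)"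
      using \<gamma> by (simp add: abs_mult)
  qed
  then show "value_fun P R \<gamma> \<pi> x = (\<Sum>t. \<gamma> ^ t * E t x)"
    by (simp add: E)
qed

text \<open>The term at time \<open>t + 1\<close> of the value series at \<open>x\<close> is \<open>\<gamma>\<close> times the average, over the
  successor \<open>y\<close> of \<open>x\<close>, of the term at time \<open>t\<close> of the series at \<open>y\<close>.\<close>

lemma value_fun_Bellman:
  fixes P :: "'x::finite \<Rightarrow> 'a \<Rightarrow> 'x pmf" and \<gamma> :: real
  assumes \<gamma>: "0 < \<gamma>" "\<gamma> < 1"
  shows "value_fun P R \<gamma> \<pi> x =
    R x (\<pi> x) + \<gamma> * (\<Sum>y\<in>UNIV. pmf (P x (\<pi> x)) y * value_fun P R \<gamma> \<pi> y)"
proof -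
  define E where "E t x = measure_pmf.expectation (state_law (\<lambda>y. P y (\<pi> y)) t x) (\<lambda>y. R y (\<pi> y))"
    for t x
  let ?p = "pmf (P x (\<pi> x))"
  have summ: "summable (\<lambda>t. \<gamma> ^ t * E t y)" for y
    unfolding E_def by (rule summable_expected_reward[OF \<gamma>])
  have V: "value_fun P R \<gamma> \<pi> y = (\<Sum>t. \<gamma> ^ t * E t y)" for y
    unfolding E_def by (rule value_fun_series[OF \<gamma>])
  have E_0: "E 0 x = R x (\<pi> x)"
    by (simp add: E_def)
  have E_Suc: "E (Suc t) x = (\<Sum>y\<in>UNIV. ?p y * E t y)" for t
    unfolding E_def state_law.simps by (subst pmf_expectation_bind[where A = UNIV]) auto
  have "value_fun P R \<gamma> \<pi> x = E 0 x + (\<Sum>t. \<gamma> ^ Suc t * E (Suc t) x)"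
    unfolding V using suminf_split_head[OF summ] by simp
  also have "(\<Sum>t. \<gamma> ^ Suc t * E (Suc t) x) = (\<Sum>t. \<Sum>y\<in>UNIV. \<gamma> * ?p y * (\<gamma> ^ t * E t y))"
    by (simp add: E_Suc sum_distrib_left mult_ac)
  also have "\<dots> = (\<Sum>y\<in>UNIV. \<gamma> * ?p y * (\<Sum>t. \<gamma> ^ t * E t y))"
    by (subst suminf_sum) (auto intro: summable_mult summ simp: suminf_mult[OF summ])
  also have "\<dots> = \<gamma> * (\<Sum>y\<in>UNIV. ?p y * value_fun P R \<gamma> \<pi> y)"
    by (simp add: V sum_distrib_left mult_ac)
  finally show ?thesis by (simp add: E_0)
qed

section \<open>Policy improvement at one state\<close>

text \<open>For a minimiser \<open>m\<close> of \<open>D\<close>, every average of \<open>D\<close> is at least \<open>D m\<close>, so a negative minimum would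
  satisfy \<open>D m < \<gamma> * D m \<le> D m\<close>.\<close>

lemma discounted_minimum_principle:
  fixes D :: "'x::finite \<Rightarrow> real" and p :: "'x \<Rightarrow> 'x pmf"
  assumes \<gamma>: "0 < \<gamma>" "\<gamma> < 1"
    and D: "\<And>s. 0 \<le> D s \<or> \<gamma> * (\<Sum>y\<in>UNIV. pmf (p s) y * D y) \<le> D s"
  shows "0 \<le> D s"
proof -
  have "Min (range D) \<in> range D"
    by (intro Min_in) auto
  then obtain m where "D m = Min (range D)" by (metis imageE)
  then have m: "D m \<le> D y" for y by simp
  have "0 \<le> D m"
  proof (rule ccontr)
    assume neg: "\<not> 0 \<le> D m"
    have "D m = (\<Sum>y\<in>UNIV. pmf (p m) y * D m)"
      by (simp flip: sum_distrib_right add: sum_pmf_eq_1)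
    also have "\<dots> \<le> (\<Sum>y\<in>UNIV. pmf (p m) y * D y)"
      by (intro sum_mono mult_left_mono m) simp
    finally have "\<gamma> * D m \<le> D m"
      using D[of m] neg \<gamma> mult_left_mono[of "D m" _ \<gamma>] by fastforce
    moreover have "D m < \<gamma> * D m"
      using neg \<gamma> by simp
    ultimately show False by simp
  qed
  then show ?thesis using m order_trans by blast
qed

lemma value_fun_mono_one_state:
  fixes P :: "'x::finite \<Rightarrow> 'a \<Rightarrow> 'x pmf" and \<gamma> :: real
  assumes \<gamma>: "0 < \<gamma>" "\<gamma> < 1"
    and eq: "\<And>s. s \<noteq> z \<Longrightarrow> \<pi>' s = \<pi> s"
    and le: "value_fun P R \<gamma> \<pi> z \<le> value_fun P R \<gamma> \<pi>' z"
  shows "value_fun P R \<gamma> \<pi> \<le> value_fun P R \<gamma> \<pi>'"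
proof (rule le_funI)
  fix s
  let ?D = "\<lambda>s. value_fun P R \<gamma> \<pi>' s - value_fun P R \<gamma> \<pi> s"
  have "0 \<le> ?D u \<or> \<gamma> * (\<Sum>y\<in>UNIV. pmf (P u (\<pi> u)) y * ?D y) \<le> ?D u" for u
  proof (cases "u = z")
    case False
    then show ?thesis
      using value_fun_Bellman[OF \<gamma>, of P R \<pi>' u] value_fun_Bellman[OF \<gamma>, of P R \<pi> u]
      by (simp add: eq right_diff_distrib sum_subtractf)
  qed (use le in simp)
  then have "0 \<le> ?D s"
    by (rule discounted_minimum_principle[OF \<gamma>])
  then show "value_fun P R \<gamma> \<pi> s \<le> value_fun P R \<gamma> \<pi>' s" by simp
qed

section \<open>The iteration\<close>

text \<open>Policy switching maximises separately at every state and so need not produce a member of the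
  set it switches over.  Here only its action at \<open>x k\<close> is used, and a one-state variant is determined
  by that action.\<close>

lemma online_PSPI_step:
  assumes "online_PSPI A P R \<gamma> \<pi> x"
  shows "is_arg_max (\<lambda>\<psi>. value_fun P R \<gamma> \<psi> (x k)) (\<lambda>\<psi>. \<psi> \<in> one_state_variants A (\<pi> k) (x k)) (\<pi> (Suc k))"
proof -
  obtain \<pi>\<^sub>p\<^sub>s where "policy_switching P R \<gamma> (one_state_variants A (\<pi> k) (x k)) \<pi>\<^sub>p\<^sub>s"
    and ps: "\<pi> (Suc k) (x k) = \<pi>\<^sub>p\<^sub>s (x k)"
    and off: "\<And>s. s \<noteq> x k \<Longrightarrow> \<pi> (Suc k) s = \<pi> k s"
    using assms unfolding online_PSPI_def by blast
  then obtain \<phi> where \<phi>: "is_arg_max (\<lambda>\<psi>. value_fun P R \<gamma> \<psi> (x k))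
      (\<lambda>\<psi>. \<psi> \<in> one_state_variants A (\<pi> k) (x k)) \<phi>" and at: "\<pi>\<^sub>p\<^sub>s (x k) = \<phi> (x k)"
    unfolding policy_switching_def by blast
  have "\<pi> (Suc k) s = \<phi> s" for s
    using \<phi> ps at off[of s] by (cases "s = x k") (auto simp: is_arg_max_def one_state_variants_def)
  then have "\<pi> (Suc k) = \<phi>" by blast
  with \<phi> show ?thesis by simp
qed

lemma online_PSPI_policies:
  assumes "online_PSPI A P R \<gamma> \<pi> x"
  shows "\<pi> k \<in> policies A"
proof (cases k)
  case 0
  then show ?thesis using assms by (simp add: online_PSPI_def)
next
  case (Suc j)
  then show ?thesis using online_PSPI_step[OF assms, of j]
    by (simp add: is_arg_max_def one_state_variants_def)
qed

theorem mainTheorem2: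
  fixes A :: "'x::finite \<Rightarrow> 'a::finite set"
    and P :: "'x \<Rightarrow> 'a \<Rightarrow> 'x pmf"
    and R :: "'x \<Rightarrow> 'a \<Rightarrow> real"
    and \<gamma> :: real
    and \<pi> :: "nat \<Rightarrow> 'x \<Rightarrow> 'a"
    and x :: "nat \<Rightarrow> 'x"
  assumes "\<And>s. A s \<noteq> {}"
    and "0 < \<gamma>" and "\<gamma> < 1"
    and "online_PSPI A P R \<gamma> \<pi> x"
  shows "\<forall>k. value_fun P R \<gamma> (\<pi> (Suc k)) \<ge> value_fun P R \<gamma> (\<pi> k)"
proof
  fix k
  note step = online_PSPI_step[OF assms(4), of k]
  have "\<pi> k \<in> one_state_variants A (\<pi> k) (x k)"
    using online_PSPI_policies[OF assms(4)] by (simp add: one_state_variants_def)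
  with step have le: "value_fun P R \<gamma> (\<pi> k) (x k) \<le> value_fun P R \<gamma> (\<pi> (Suc k)) (x k)"
    by (auto simp: is_arg_max_def not_less)
  show "value_fun P R \<gamma> (\<pi> k) \<le> value_fun P R \<gamma> (\<pi> (Suc k))"
    using step by (intro value_fun_mono_one_state[OF assms(2,3) _ le])
      (auto simp: is_arg_max_def one_state_variants_def)
qed

end
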